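(* Let $A_1$ and $A_2$ be real unital associative algebras, each with underlying vector space of elements $\mathbb{R}^n$ ($n\ge 1$), and let $K:A_1\to A_2$ be an algebra isomorphism, identified with its nonsingular $n\times n$ matrix with respect to the standard basis. Then $$\mathfrak{u}_{A_1}=K^T\,\mathfrak{u}_{A_2}\,K,$$ where $K^T\mathfrak{u}_{A_2}K:=\{K^TLK : L\in\mathfrak{u}_{A_2}\}$ and $\mathfrak{u}_A$ denotes the anti-rotor of $A$, i.e. the real vector space of uncurling metrics of $A$.
   Context: All algebras are real, unital, associative, with vector space of elements $\mathbb{R}^n$, the standard topology, and the standard basis; elements are column vectors, $^T$ is transpose, and $\cdot$ is the usual dot product. For an algebra $A$ with multiplicative identity $\mathbf{1}$, an uncurling metric of $A$ is a real symmetric $n\times n$ matrix $L$ such that, on some neighborhood of $\mathbf{1}$ consisting only of units (invertible elements), the differential 1-form $(Ls^{-1})\cdot \mathbf{d}s=(s^{-1})^TL\,\mathbf{d}s$ is closed, i.e. $d\big((s^{-1})^TL\,\mathbf{d}s\big)=0$. Here $s^{-1}$ is the multiplicative inverse of $s$ in $A$, $\mathbf{d}s=(dx_1,\dots,dx_n)^T$, and $d$ is the exterior derivative. The set of uncurling metrics of $A$ is a real vector space, called the anti-rotor of $A$ and denoted $\mathfrak{u}_A$. *)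

theory Defs
  imports "HOL-Analysis.Analysis"
begin

text \<open>An algebra with vector space of elements \<open>real ^ 'n\<close> is given by its product \<open>m\<close> and its
  multiplicative identity \<open>e\<close>.\<close>

definition unital_algebra ::
    "(real ^ 'n \<Rightarrow> real ^ 'n \<Rightarrow> real ^ 'n) \<Rightarrow> real ^ 'n \<Rightarrow> bool" where
  "unital_algebra m e \<longleftrightarrow>
     bilinear m \<and>
     (\<forall>x y z. m (m x y) z = m x (m y z)) \<and>
     (\<forall>x. m e x = x) \<and> (\<forall>x. m x e = x)"

definition algebra_isomorphism ::
    "(real ^ 'n \<Rightarrow> real ^ 'n \<Rightarrow> real ^ 'n) \<Rightarrow> real ^ 'n \<Rightarrow>
     (real ^ 'n \<Rightarrow> real ^ 'n \<Rightarrow> real ^ 'n) \<Rightarrow> real ^ 'n \<Rightarrow>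
     (real ^ 'n \<Rightarrow> real ^ 'n) \<Rightarrow> bool" where
  "algebra_isomorphism m1 e1 m2 e2 K \<longleftrightarrow>
     linear K \<and> bij K \<and> (\<forall>x y. K (m1 x y) = m2 (K x) (K y)) \<and> K e1 = e2"

definition alg_units ::
    "(real ^ 'n \<Rightarrow> real ^ 'n \<Rightarrow> real ^ 'n) \<Rightarrow> real ^ 'n \<Rightarrow> (real ^ 'n) set" where
  "alg_units m e = {s. \<exists>t. m s t = e \<and> m t s = e}"

text \<open>Meaningful only on \<open>alg_units m e\<close>.\<close>

definition alg_inverse ::
    "(real ^ 'n \<Rightarrow> real ^ 'n \<Rightarrow> real ^ 'n) \<Rightarrow> real ^ 'n \<Rightarrow> real ^ 'n \<Rightarrow> real ^ 'n" where
  "alg_inverse m e s = (THE t. m s t = e \<and> m t s = e)"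

text \<open>A differential 1-form is a map into the dual space. With
  \<open>\<omega> = (\<Sum>j. f\<^sub>j dx\<^sub>j)\<close> one has
  \<open>d\<omega> = (\<Sum>i<j. (\<partial>\<^sub>i f\<^sub>j - \<partial>\<^sub>j f\<^sub>i) dx\<^sub>i \<and> dx\<^sub>j)\<close>; the definition below is this 2-form evaluated
  on a pair of vectors. It is meaningful only where \<open>\<omega>\<close> is differentiable.\<close>

definition exterior_derivative ::
    "('a::real_normed_vector \<Rightarrow> 'a \<Rightarrow>\<^sub>L real) \<Rightarrow> 'a \<Rightarrow> 'a \<Rightarrow> 'a \<Rightarrow> real" where
  "exterior_derivative \<omega> x u v =
     blinfun_apply (frechet_derivative \<omega> (at x) u) v
   - blinfun_apply (frechet_derivative \<omega> (at x) v) u"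

text \<open>Intended for open \<open>U\<close>.\<close>

definition closed_form_on ::
    "('a::real_normed_vector) set \<Rightarrow> ('a \<Rightarrow> 'a \<Rightarrow>\<^sub>L real) \<Rightarrow> bool" where
  "closed_form_on U \<omega> \<longleftrightarrow>
     \<omega> differentiable_on U \<and> (\<forall>x\<in>U. \<forall>u v. exterior_derivative \<omega> x u v = 0)"

definition uncurling_metric ::
    "(real ^ 'n \<Rightarrow> real ^ 'n \<Rightarrow> real ^ 'n) \<Rightarrow> real ^ 'n \<Rightarrow> real ^ 'n ^ 'n \<Rightarrow> bool" where
  "uncurling_metric m e L \<longleftrightarrow>
     transpose L = L \<and>
     (\<exists>U. open U \<and> e \<in> U \<and> U \<subseteq> alg_units m e \<and>
          closed_form_on U (\<lambda>s. blinfun_inner_right (L *v alg_inverse m e s)))"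

definition anti_rotor ::
    "(real ^ 'n \<Rightarrow> real ^ 'n \<Rightarrow> real ^ 'n) \<Rightarrow> real ^ 'n \<Rightarrow> (real ^ 'n ^ 'n) set" where
  "anti_rotor m e = {L. uncurling_metric m e L}"

end

theory Submission
  imports Defs
begin

text \<open>An algebra isomorphism \<open>K\<close> carries inverses to inverses, so for every unit \<open>s\<close> of the first
  algebra and every vector \<open>v\<close>, writing \<open>M\<close> for the matrix of \<open>K\<close>,
  \<open>(M\<^sup>T L M s\<^sup>-\<^sup>1) \<bullet> v = (L (K s)\<^sup>-\<^sup>1) \<bullet> K v\<close>.
  In other words, the 1-form of the metric \<open>M\<^sup>T L M\<close> is the pullback along \<open>K\<close> of the 1-form of \<open>L\<close>.
  The exterior derivative commutes with pullbacks, so closedness of the latter near the identity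
  gives closedness of the former (lemma \<open>closed_form_on_pullback\<close>); hence congruence by \<open>M\<close> maps
  uncurling metrics of the second algebra to uncurling metrics of the first
  (lemma \<open>uncurling_metric_congruence\<close>). The other inclusion is the same statement for the
  isomorphism \<open>K\<^sup>-\<^sup>1\<close>, since congruence by \<open>M\<^sup>-\<^sup>1\<close> undoes congruence by \<open>M\<close>.\<close>

lemma alg_inverse_eqI:
  assumes "unital_algebra m e" "m s t = e" "m t s = e"
  shows "alg_inverse m e s = t"
  unfolding alg_inverse_def
proof (rule the_equality)
  show "m s t = e \<and> m t s = e" using assms by simp
next
  fix t' assume t': "m s t' = e \<and> m t' s = e"
  have "t' = m t' (m s t)" using assms by (simp add: unital_algebra_def)
  also have "\<dots> = m (m t' s) t" using assms(1) by (simp add: unital_algebra_def)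
  also have "\<dots> = t" using t' assms(1) by (simp add: unital_algebra_def)
  finally show "t' = t" .
qed

lemma algebra_isomorphism_inv:
  assumes "algebra_isomorphism m1 e1 m2 e2 K"
  shows "algebra_isomorphism m2 e2 m1 e1 (inv K)"
proof -
  have K: "linear K" "bij K" "K (m1 x y) = m2 (K x) (K y)" "K e1 = e2" for x y
    using assms by (auto simp: algebra_isomorphism_def)
  note inj = bij_is_inj[OF K(2)] and surj = bij_is_surj[OF K(2)]
  have "inv K (m2 x y) = m1 (inv K x) (inv K y)" for x y
    by (rule inv_f_eq[OF inj]) (simp add: K(3) surj_f_inv_f[OF surj])
  moreover have "inv K e2 = e1" by (rule inv_f_eq[OF inj K(4)])
  moreover have "linear (inv K)" by (rule inj_linear_imp_inv_linear[OF K(1) inj])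
  ultimately show ?thesis
    using bij_imp_bij_inv[OF K(2)] by (simp add: algebra_isomorphism_def)
qed

lemma algebra_isomorphism_units:
  assumes "algebra_isomorphism m1 e1 m2 e2 K" "s \<in> alg_units m1 e1"
  shows "K s \<in> alg_units m2 e2"
  using assms unfolding algebra_isomorphism_def alg_units_def mem_Collect_eq by metis

lemma algebra_isomorphism_inverse:
  assumes "unital_algebra m1 e1" "unital_algebra m2 e2"
    and iso: "algebra_isomorphism m1 e1 m2 e2 K" and "s \<in> alg_units m1 e1"
  shows "alg_inverse m2 e2 (K s) = K (alg_inverse m1 e1 s)"
proof -
  obtain t where t: "m1 s t = e1" "m1 t s = e1"
    using assms(4) by (auto simp: alg_units_def)
  have "m2 (K s) (K t) = e2" "m2 (K t) (K s) = e2"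
    using t iso unfolding algebra_isomorphism_def by metis+
  then show ?thesis
    using alg_inverse_eqI[OF assms(2)] alg_inverse_eqI[OF assms(1) t] by simp
qed

text \<open>Off the units, \<open>alg_inverse\<close> has an arbitrary value that an isomorphism need not preserve, so
  the 1-form of one algebra is known to be the pullback of the other only on an open set of units;
  closedness is local enough to be transferred there.\<close>

lemma closed_form_on_cong:
  assumes "open U" "closed_form_on U \<omega>" and eq: "\<And>x. x \<in> U \<Longrightarrow> \<omega>' x = \<omega> x"
  shows "closed_form_on U \<omega>'"
proof -
  have der: "(\<omega>' has_derivative frechet_derivative \<omega> (at x)) (at x)" if "x \<in> U" for x
  proof -
    have "\<omega> differentiable at x"
      using assms(1,2) that by (simp add: closed_form_on_def differentiable_on_eq_differentiable_at)
    then have "(\<omega> has_derivative frechet_derivative \<omega> (at x)) (at x)"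
      by (simp add: frechet_derivative_works)
    then show ?thesis
      by (rule has_derivative_transform_within_open[OF _ assms(1) that]) (simp add: eq)
  qed
  have "exterior_derivative \<omega>' x u v = exterior_derivative \<omega> x u v" if "x \<in> U" for x u v
    using frechet_derivative_at[OF der[OF that]] by (simp add: exterior_derivative_def)
  moreover have "\<omega>' differentiable_on U"
    using der assms(1) by (auto simp: differentiable_on_eq_differentiable_at differentiable_def)
  ultimately show ?thesis
    using assms(2) by (simp add: closed_form_on_def)
qed

text \<open>The identity \<open>d (K\<^sup>* \<omega>) = K\<^sup>* (d \<omega>)\<close> for a bounded linear \<open>K\<close>: the derivative of
  \<open>K\<^sup>* \<omega>\<close> at \<open>x\<close> in direction \<open>u\<close> is that of \<open>\<omega>\<close> at \<open>K x\<close> in direction \<open>K u\<close>, restricted along \<open>K\<close>;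
  no second derivative of \<open>K\<close> enters, as \<open>K\<close> is its own derivative everywhere.\<close>

lemma closed_form_on_pullback:
  fixes K :: "'a::real_normed_vector \<Rightarrow>\<^sub>L 'b::real_normed_vector"
  assumes "open U" "closed_form_on U \<omega>"
  shows "closed_form_on (blinfun_apply K -` U) (\<lambda>x. \<omega> (blinfun_apply K x) o\<^sub>L K)"
proof -
  let ?\<eta> = "\<lambda>x. \<omega> (blinfun_apply K x) o\<^sub>L K"
  let ?D = "\<lambda>x u. frechet_derivative \<omega> (at (blinfun_apply K x)) (blinfun_apply K u) o\<^sub>L K"
  have op: "open (blinfun_apply K -` U)"
    by (intro open_vimage assms(1) continuous_intros)
  have der: "(?\<eta> has_derivative ?D x) (at x)" if "blinfun_apply K x \<in> U" for x
  proof -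
    have "\<omega> differentiable at (blinfun_apply K x)"
      using assms that by (simp add: closed_form_on_def differentiable_on_eq_differentiable_at)
    then have "(\<omega> has_derivative frechet_derivative \<omega> (at (blinfun_apply K x)))
        (at (blinfun_apply K x))"
      by (simp add: frechet_derivative_works)
    moreover have "(blinfun_apply K has_derivative blinfun_apply K) (at x)"
      by (intro bounded_linear_imp_has_derivative blinfun.bounded_linear_right)
    ultimately have "((\<lambda>x. \<omega> (blinfun_apply K x)) has_derivative
        (\<lambda>u. frechet_derivative \<omega> (at (blinfun_apply K x)) (blinfun_apply K u))) (at x)"
      by (rule has_derivative_compose[rotated])
    then show ?thesis
      by (rule bounded_linear.has_derivative[OF
            bounded_bilinear.bounded_linear_left[OF bounded_bilinear_blinfun_compose]])
  qed
  have "exterior_derivative ?\<eta> x u v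
      = exterior_derivative \<omega> (blinfun_apply K x) (blinfun_apply K u) (blinfun_apply K v)"
    if "blinfun_apply K x \<in> U" for x u v
    by (simp add: exterior_derivative_def frechet_derivative_at[OF der[OF that], symmetric])
  moreover have "?\<eta> differentiable_on (blinfun_apply K -` U)"
    using der op by (auto simp: differentiable_on_eq_differentiable_at differentiable_def)
  ultimately show ?thesis
    using assms(2) by (simp add: closed_form_on_def)
qed

lemma uncurling_metric_congruence:
  fixes K :: "real ^ 'n \<Rightarrow> real ^ 'n"
  assumes alg: "unital_algebra m1 e1" "unital_algebra m2 e2"
    and iso: "algebra_isomorphism m1 e1 m2 e2 K"
    and L: "uncurling_metric m2 e2 L"
  shows "uncurling_metric m1 e1 (transpose (matrix K) ** L ** matrix K)"
proof -
  have K: "linear K" "bij K" "K e1 = e2"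
    using iso by (auto simp: algebra_isomorphism_def)
  let ?L = "transpose (matrix K) ** L ** matrix K"
  define B where "B = Blinfun K"
  have B: "blinfun_apply B = K"
    using K(1) by (simp add: B_def bounded_linear_Blinfun_apply linear_conv_bounded_linear)
  from L obtain U where sym: "transpose L = L" and U: "open U" "e2 \<in> U" "U \<subseteq> alg_units m2 e2"
    and closed: "closed_form_on U (\<lambda>s. blinfun_inner_right (L *v alg_inverse m2 e2 s))"
    by (auto simp: uncurling_metric_def)
  have op: "open (K -` U)"
    using U(1) K(1) by (simp add: continuous_open_vimage linear_continuous_at linear_linear)
  have units: "s \<in> alg_units m1 e1" if "K s \<in> U" for s
    using algebra_isomorphism_units[OF algebra_isomorphism_inv[OF iso], of "K s"] that U(3) K(2)
    by (auto simp: bij_is_inj)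
  have "blinfun_inner_right (?L *v alg_inverse m1 e1 s)
      = blinfun_inner_right (L *v alg_inverse m2 e2 (K s)) o\<^sub>L B" if "K s \<in> U" for s
  proof (rule blinfun_eqI)
    fix v
    have "?L *v alg_inverse m1 e1 s = transpose (matrix K) *v (L *v K (alg_inverse m1 e1 s))"
      using K(1) by (simp add: matrix_works flip: matrix_vector_mul_assoc)
    then have "(?L *v alg_inverse m1 e1 s) \<bullet> v = (L *v K (alg_inverse m1 e1 s)) \<bullet> K v"
      using K(1) by (simp add: dot_lmul_matrix matrix_works)
    then show "blinfun_apply (blinfun_inner_right (?L *v alg_inverse m1 e1 s)) v
        = blinfun_apply (blinfun_inner_right (L *v alg_inverse m2 e2 (K s)) o\<^sub>L B) v"
      by (simp add: B algebra_isomorphism_inverse[OF alg iso units[OF that]])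
  qed
  then have "closed_form_on (K -` U) (\<lambda>s. blinfun_inner_right (?L *v alg_inverse m1 e1 s))"
    using closed_form_on_cong[OF op] closed_form_on_pullback[OF U(1) closed, of B]
    by (simp add: B)
  moreover have "transpose ?L = ?L"
    by (simp add: matrix_transpose_mul sym matrix_mul_assoc)
  moreover have "e1 \<in> K -` U" using U(2) K(3) by simp
  ultimately show ?thesis
    using op units unfolding uncurling_metric_def by blast
qed

theorem theorem2p2:
  fixes m1 m2 :: "real ^ 'n \<Rightarrow> real ^ 'n \<Rightarrow> real ^ 'n"
    and e1 e2 :: "real ^ 'n"
    and K :: "real ^ 'n \<Rightarrow> real ^ 'n"
  assumes "unital_algebra m1 e1"
    and "unital_algebra m2 e2"
    and "algebra_isomorphism m1 e1 m2 e2 K"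
  shows "anti_rotor m1 e1 = {transpose (matrix K) ** L ** matrix K | L. L \<in> anti_rotor m2 e2}"
proof (intro set_eqI iffI)
  fix M assume "M \<in> {transpose (matrix K) ** L ** matrix K | L. L \<in> anti_rotor m2 e2}"
  then show "M \<in> anti_rotor m1 e1"
    using uncurling_metric_congruence[OF assms] by (auto simp: anti_rotor_def)
next
  fix M assume M: "M \<in> anti_rotor m1 e1"
  let ?P = "matrix K" and ?Q = "matrix (inv K)"
  let ?L = "transpose ?Q ** M ** ?Q"
  note iso_inv = algebra_isomorphism_inv[OF assms(3)]
  have "linear K" "linear (inv K)" "bij K"
    using assms(3) iso_inv by (auto simp: algebra_isomorphism_def)
  then have QP: "?Q ** ?P = mat 1"
    using matrix_compose[of K "inv K"] by (simp add: inv_o_cancel bij_is_inj matrix_id_mat_1)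
  have "?L \<in> anti_rotor m2 e2"
    using uncurling_metric_congruence[OF assms(2,1) iso_inv] M by (simp add: anti_rotor_def)
  moreover have "transpose ?P ** ?L ** ?P = M"
  proof -
    have "transpose ?P ** ?L ** ?P = transpose (?Q ** ?P) ** M ** (?Q ** ?P)"
      by (simp add: matrix_transpose_mul matrix_mul_assoc)
    then show ?thesis by (simp add: QP transpose_mat)
  qed
  ultimately show "M \<in> {transpose (matrix K) ** L ** matrix K | L. L \<in> anti_rotor m2 e2}"
    by force
qed

end
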